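(* Let $\mathbf{A}\in\mathbb{R}^{d\times d}$ and let the linear operator $F(x)=\mathbf{A}x$ on $\mathbb{R}^d$ be monotone and $L$-Lipschitz. Assume that the (complex) spectrum of $\mathbf{A}$ contains at least one eigenvalue $\hat\lambda$ with $\mathrm{Re}(\hat\lambda)=0$ and $\mathrm{Im}(\hat\lambda)\neq 0$. Let $x^*\in\mathbb{R}^d$ satisfy $F(x^* )=0$ and put $z^*=(x^*,x^* )\in\mathbb{R}^{2d}$. Then for any $\ell>0$ and $\gamma>0$ neither of the operators $F_{\mathrm{OG},\gamma},F_{\mathrm{EFTP},\gamma}:\mathbb{R}^{2d}\to\mathbb{R}^{2d}$, $$F_{\mathrm{OG},\gamma}\begin{pmatrix}x\\ y\end{pmatrix}=\begin{pmatrix}2F(x)-F(y)\\ -\frac1\gamma x+\frac1\gamma y\end{pmatrix},\qquad F_{\mathrm{EFTP},\gamma}\begin{pmatrix}x\\ y\end{pmatrix}=\begin{pmatrix}F\left(x-\gamma F(y)\right)\\ \frac1\gamma(y-x)+F(y)\end{pmatrix},$$ is $\ell$-star-cocoercive around $z^*$.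
   Context: $\langle\cdot,\cdot\rangle$ and $\|\cdot\|$ are the standard Euclidean inner product and norm. $F$ is monotone if $\langle F(x)-F(x'),x-x'\rangle\ge 0$ for all $x,x'$, and $L$-Lipschitz if $\|F(x)-F(x')\|\le L\|x-x'\|$ for all $x,x'$. An operator $G:\mathbb{R}^n\to\mathbb{R}^n$ is $\ell$-star-cocoercive around $z^*$ if $G(z^* )=0$ and $\|G(z)\|^2\le\ell\langle G(z),z-z^*\rangle$ for all $z\in\mathbb{R}^n$. The operators in the claim are the update operators of the Optimistic Gradient method and of Extrapolation from the Past, written as $z^{k+1}=z^k-\gamma G(z^k)$ on $\mathbb{R}^{2d}$. *)

theory Defs
  imports "HOL-Analysis.Analysis"
begin

definition monotone_operator :: "('a::real_inner \<Rightarrow> 'a) \<Rightarrow> bool" where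
  "monotone_operator F \<longleftrightarrow> (\<forall>x x'. (F x - F x') \<bullet> (x - x') \<ge> 0)"

definition star_cocoercive :: "real \<Rightarrow> ('a::real_inner \<Rightarrow> 'a) \<Rightarrow> 'a \<Rightarrow> bool" where
  "star_cocoercive l G zs \<longleftrightarrow> G zs = 0 \<and> (\<forall>z. (norm (G z))\<^sup>2 \<le> l * (G z \<bullet> (z - zs)))"

definition complex_spectrum :: "real ^ 'n ^ 'n \<Rightarrow> complex set" where
  "complex_spectrum A = {c. \<exists>v::complex ^ 'n. v \<noteq> 0 \<and> map_matrix complex_of_real A *v v = c *s v}"

text \<open>
  The space of pairs \<open>(x, y)\<close> is the product type; its norm and inner product are the Euclidean
  ones of the concatenated vector. For \<open>\<gamma> \<noteq> 0\<close>, the step \<open>z - \<gamma> *\<^sub>R G z\<close> sends \<open>(x, y)\<close> to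
  \<open>(x - \<gamma> *\<^sub>R (2 *\<^sub>R F x - F y), x)\<close> for \<open>OG_operator\<close>, and to
  \<open>(x - \<gamma> *\<^sub>R F w, w)\<close> with \<open>w = x - \<gamma> *\<^sub>R F y\<close> for \<open>EFTP_operator\<close>.
\<close>

definition OG_operator :: "('a::real_inner \<Rightarrow> 'a) \<Rightarrow> real \<Rightarrow> 'a \<times> 'a \<Rightarrow> 'a \<times> 'a" where
  "OG_operator F \<gamma> = (\<lambda>(x, y).
     (2 *\<^sub>R F x - F y, - ((1 / \<gamma>) *\<^sub>R x) + (1 / \<gamma>) *\<^sub>R y))"

definition EFTP_operator :: "('a::real_inner \<Rightarrow> 'a) \<Rightarrow> real \<Rightarrow> 'a \<times> 'a \<Rightarrow> 'a \<times> 'a" where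
  "EFTP_operator F \<gamma> = (\<lambda>(x, y).
     (F (x - \<gamma> *\<^sub>R F y), (1 / \<gamma>) *\<^sub>R (y - x) + F y))"

end

theory Submission
  imports Defs
begin

text \<open>
  An eigenvector \<open>p + \<i> q\<close> for \<open>\<i> b\<close> with \<open>b \<noteq> 0\<close> gives \<open>A p = - b q\<close> and \<open>A q = b p\<close>, and
  monotonicity applied to \<open>p\<close> and to \<open>q\<close> forces \<open>p \<bullet> q = 0\<close>; in this plane \<open>A\<close> acts like a
  rotation. At \<open>z = z\<^sup>* + (p, p)\<close> the OG operator is \<open>(A p, 0) \<noteq> 0\<close>, which is orthogonal to
  \<open>z - z\<^sup>*\<close>. At \<open>z = z\<^sup>* + (t q, p)\<close> the inner product of the EFTP operator with \<open>z - z\<^sup>*\<close> is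
  \<open>(norm p)\<^sup>2 / \<gamma>\<close> for every \<open>t\<close>, while the operator itself is unbounded in \<open>t\<close>.
\<close>

text \<open>Both equations are the real and imaginary parts of the complex eigenvector equation. As
  \<open>Im c\<close> is nonzero, they make \<open>p\<close> and \<open>q\<close> vanish together,
  so neither is zero.\<close>

lemma complex_spectrum_imaginary_eigenplane:
  fixes A :: "real ^ 'n ^ 'n"
  assumes c: "c \<in> complex_spectrum A" and Re: "Re c = 0" and Im: "Im c \<noteq> 0"
  obtains p q where "A *v p = - (Im c *\<^sub>R q)" "A *v q = Im c *\<^sub>R p" "p \<noteq> 0" "q \<noteq> 0"
proof -
  from c obtain v :: "complex ^ 'n" where v: "v \<noteq> 0"
    and ev: "map_matrix complex_of_real A *v v = c *s v"
    unfolding complex_spectrum_def by blast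
  define p :: "real ^ 'n" where "p = (\<chi> i. Re (v $ i))"
  define q :: "real ^ 'n" where "q = (\<chi> i. Im (v $ i))"
  have ev_i: "(\<Sum>j\<in>UNIV. complex_of_real (A $ i $ j) * v $ j) = c * v $ i" for i
    using arg_cong[OF ev, of "\<lambda>w. w $ i"]
    by (simp add: matrix_vector_mult_def map_matrix_def)
  have Ap: "A *v p = - (Im c *\<^sub>R q)"
    using arg_cong[OF ev_i, of Re] Re
    by (simp add: vec_eq_iff matrix_vector_mult_def p_def q_def)
  have Aq: "A *v q = Im c *\<^sub>R p"
    using arg_cong[OF ev_i, of Im] Re
    by (simp add: vec_eq_iff matrix_vector_mult_def p_def q_def)
  have "p \<noteq> 0 \<or> q \<noteq> 0"
    using v by (auto simp: vec_eq_iff p_def q_def complex_eq_iff)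
  moreover have "p = 0 \<longleftrightarrow> q = 0"
    using Ap Aq Im by auto
  ultimately show thesis
    using that[OF Ap Aq] by blast
qed

text \<open>\<open>F p \<bullet> p\<close> and \<open>F q \<bullet> q\<close> are opposite multiples
  of \<open>p \<bullet> q\<close>, and neither may be negative.\<close>

lemma monotone_operator_eigenplane_orthogonal:
  fixes F :: "'a::real_inner \<Rightarrow> 'a"
  assumes mono: "monotone_operator F" and F0: "F 0 = 0"
    and Fp: "F p = - (b *\<^sub>R q)" and Fq: "F q = b *\<^sub>R p" and b: "b \<noteq> 0"
  shows "p \<bullet> q = 0"
proof -
  have "F x \<bullet> x \<ge> 0" for x
    using mono F0 unfolding monotone_operator_def by (metis diff_zero)
  from this[of p] this[of q] have "b * (p \<bullet> q) = 0"
    by (simp add: Fp Fq inner_commute)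
  then show ?thesis
    using b by simp
qed

lemma OG_operator_not_star_cocoercive:
  fixes F :: "'a::real_inner \<Rightarrow> 'a"
  assumes lin: "linear F" and sol: "F xs = 0" and Fp: "F p \<noteq> 0" and orth: "F p \<bullet> p = 0"
  shows "\<not> star_cocoercive l (OG_operator F \<gamma>) (xs, xs)"
proof
  assume "star_cocoercive l (OG_operator F \<gamma>) (xs, xs)"
  then have "(norm (OG_operator F \<gamma> (xs + p, xs + p)))\<^sup>2
      \<le> l * (OG_operator F \<gamma> (xs + p, xs + p) \<bullet> ((xs + p, xs + p) - (xs, xs)))"
    unfolding star_cocoercive_def by blast
  moreover have "OG_operator F \<gamma> (xs + p, xs + p) = (F p, 0)"
    by (simp add: OG_operator_def linear_add[OF lin] sol scaleR_2)
  ultimately have "(norm (F p))\<^sup>2 \<le> 0"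
    by (simp add: norm_Pair orth)
  then show False
    using Fp by simp
qed

lemma EFTP_operator_not_star_cocoercive:
  fixes F :: "'a::real_inner \<Rightarrow> 'a"
  assumes lin: "linear F" and sol: "F xs = 0"
    and Fp: "F p = - (b *\<^sub>R q)" and Fq: "F q = b *\<^sub>R p" and orth: "p \<bullet> q = 0"
    and b: "b \<noteq> 0" and p: "p \<noteq> 0" and l: "l > 0" and \<gamma>: "\<gamma> > 0"
  shows "\<not> star_cocoercive l (EFTP_operator F \<gamma>) (xs, xs)"
proof
  \<comment> \<open>All that matters is that the square of \<open>?s\<close> exceeds
    \<open>l / \<gamma>\<close>; this choice avoids a square root.\<close>
  let ?s = "1 + l / \<gamma>"
  \<comment> \<open>chosen so that the first component of the operator is \<open>?s *\<^sub>R p\<close>\<close>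
  define t where "t = ?s / b - \<gamma> * b"
  let ?z = "(xs + t *\<^sub>R q, xs + p)"
  let ?G = "EFTP_operator F \<gamma> ?z"
  assume "star_cocoercive l (EFTP_operator F \<gamma>) (xs, xs)"
  then have le: "(norm ?G)\<^sup>2 \<le> l * (?G \<bullet> (?z - (xs, xs)))"
    unfolding star_cocoercive_def by blast
  have "xs + t *\<^sub>R q - \<gamma> *\<^sub>R F (xs + p) = xs + (?s / b) *\<^sub>R q"
    by (simp add: linear_add[OF lin] sol Fp t_def algebra_simps)
  moreover have "F (xs + (?s / b) *\<^sub>R q) = ?s *\<^sub>R p"
    using b by (simp add: linear_add[OF lin] linear_scale[OF lin] sol Fq)
  ultimately have "F (xs + t *\<^sub>R q - \<gamma> *\<^sub>R F (xs + p)) = ?s *\<^sub>R p"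
    by (simp only:)
  moreover have "F (xs + p) = - (b *\<^sub>R q)"
    by (simp add: linear_add[OF lin] sol Fp)
  ultimately have G: "?G = (?s *\<^sub>R p, (1 / \<gamma>) *\<^sub>R (p - t *\<^sub>R q) - b *\<^sub>R q)"
    by (simp add: EFTP_operator_def)
  \<comment> \<open>Every term with \<open>t\<close> or \<open>b\<close> carries the factor
    \<open>p \<bullet> q\<close> and vanishes.\<close>
  have "?G \<bullet> (?z - (xs, xs)) = (norm p)\<^sup>2 / \<gamma>"
    using orth by (simp add: G inner_diff_left inner_commute[of q p] power2_norm_eq_inner)
  \<comment> \<open>The second component can only increase the norm, so it is dropped.\<close>
  moreover have "(?s * norm p)\<^sup>2 \<le> (norm ?G)\<^sup>2"
    using l \<gamma> by (simp add: G norm_Pair power_mult_distrib)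
  ultimately have "?s\<^sup>2 * (norm p)\<^sup>2 \<le> l / \<gamma> * (norm p)\<^sup>2"
    using le by (simp add: power_mult_distrib)
  then have "?s\<^sup>2 \<le> l / \<gamma>"
    by (rule mult_right_le_imp_le) (use p in simp)
  moreover have "?s\<^sup>2 = 1 + 2 * (l / \<gamma>) + (l / \<gamma>)\<^sup>2"
    by (simp add: power2_eq_square algebra_simps)
  ultimately show False
    using divide_pos_pos[OF l \<gamma>] zero_le_power2[of "l / \<gamma>"] by linarith
qed

theorem theorem4p1:
  fixes A :: "real ^ 'd ^ 'd" and F :: "real ^ 'd \<Rightarrow> real ^ 'd"
    and L l \<gamma> :: real and xs :: "real ^ 'd"
  assumes F_eq: "F = (\<lambda>x. A *v x)"
    and mono: "monotone_operator F"
    and lip: "L-lipschitz_on UNIV F"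
    and spec: "\<exists>c \<in> complex_spectrum A. Re c = 0 \<and> Im c \<noteq> 0"
    and sol: "F xs = 0"
    and l_pos: "l > 0"
    and gamma_pos: "\<gamma> > 0"
  shows "\<not> star_cocoercive l (OG_operator F \<gamma>) (xs, xs) \<and>
         \<not> star_cocoercive l (EFTP_operator F \<gamma>) (xs, xs)"
proof -
  from spec obtain c where c: "c \<in> complex_spectrum A" "Re c = 0" and b: "Im c \<noteq> 0"
    by blast
  from complex_spectrum_imaginary_eigenplane[OF c b] obtain p q
    where Fp: "F p = - (Im c *\<^sub>R q)" and Fq: "F q = Im c *\<^sub>R p" and p: "p \<noteq> 0" and q: "q \<noteq> 0"
    unfolding F_eq by metis
  have lin: "linear F"
    unfolding F_eq by (rule matrix_vector_mul_linear)
  have orth: "p \<bullet> q = 0"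
    using monotone_operator_eigenplane_orthogonal[OF mono linear_0[OF lin] Fp Fq b] .
  \<comment> \<open>\<open>F p\<close> is a nonzero multiple of \<open>q\<close>.\<close>
  have "F p \<noteq> 0" "F p \<bullet> p = 0"
    using Fp b q orth by (simp_all add: inner_commute)
  then show ?thesis
    using OG_operator_not_star_cocoercive[OF lin sol]
      EFTP_operator_not_star_cocoercive[OF lin sol Fp Fq orth b p l_pos gamma_pos]
    by blast
qed

end
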